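(* Let $f(z)=z+\sum_{n\ge 2}a_nz^n$ belong to $\mathcal{S}^*_B$, and let $\mathcal{H}_{2,2}(f)=a_2a_4-a_3^2$. Then $$|\mathcal{H}_{2,2}(f)|\le\frac14.$$ This inequality is sharp, i.e. equality holds for some function in $\mathcal{S}^*_B$.
   Context: Let $\mathbb{D}=\{z\in\mathbb{C}:|z|<1\}$ and let $\mathcal{A}$ be the class of analytic functions $f$ on $\mathbb{D}$ with $f(0)=0$, $f'(0)=1$, written $f(z)=z+\sum_{n=2}^\infty a_nz^n$. For analytic functions $g,h$ on $\mathbb{D}$, $g\prec h$ ($g$ is subordinate to $h$) means $g(z)=h(w(z))$ on $\mathbb{D}$ for some analytic $w:\mathbb{D}\to\mathbb{D}$ with $w(0)=0$. Let $B(z)=\dfrac{1}{1-\log(1+z)}$ on $\mathbb{D}$ (principal branch of the logarithm), and let $$\mathcal{S}^*_B=\left\{f\in\mathcal{A}:\ \frac{zf'(z)}{f(z)}\prec B(z)\right\}.$$ *)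

theory Defs
  imports "HOL-Complex_Analysis.Complex_Analysis"
begin

abbreviation unit_disc :: "complex set" where
  "unit_disc \<equiv> ball 0 1"

text \<open>Functions analytic on the disc are total functions of type
  \<^typ>\<open>complex \<Rightarrow> complex\<close>; their values outside the disc are irrelevant.\<close>

definition class_A :: "(complex \<Rightarrow> complex) set" where
  "class_A = {f. f holomorphic_on unit_disc \<and> f 0 = 0 \<and> deriv f 0 = 1}"

definition subordinate :: "(complex \<Rightarrow> complex) \<Rightarrow> (complex \<Rightarrow> complex) \<Rightarrow> bool" where
  "subordinate g h \<longleftrightarrow>
     g holomorphic_on unit_disc \<and> h holomorphic_on unit_disc \<and>
     (\<exists>w. w holomorphic_on unit_disc \<and> w ` unit_disc \<subseteq> unit_disc \<and> w 0 = 0 \<and>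
          (\<forall>z\<in>unit_disc. g z = h (w z)))"

definition B_fun :: "complex \<Rightarrow> complex" where
  "B_fun z = 1 / (1 - Ln (1 + z))"

text \<open>For \<open>f\<close> in the class, \<open>z f'(z) / f(z)\<close> has a removable singularity at the
  origin with value \<open>1\<close>, whereas the formula itself would give \<open>0 / 0 = 0\<close> there.\<close>

definition log_deriv_quot :: "(complex \<Rightarrow> complex) \<Rightarrow> complex \<Rightarrow> complex" where
  "log_deriv_quot f z = (if z = 0 then 1 else z * deriv f z / f z)"

text \<open>The nonvanishing condition is implicit in the quotient being defined on the disc.\<close>

definition starlike_B :: "(complex \<Rightarrow> complex) set" where
  "starlike_B = {f \<in> class_A. (\<forall>z\<in>unit_disc - {0}. f z \<noteq> 0) \<and>
                              subordinate (log_deriv_quot f) B_fun}"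

definition taylor_coeff :: "(complex \<Rightarrow> complex) \<Rightarrow> nat \<Rightarrow> complex" where
  "taylor_coeff f n = fps_nth (fps_expansion f 0) n"

definition hankel_2_2 :: "(complex \<Rightarrow> complex) \<Rightarrow> complex" where
  "hankel_2_2 f = taylor_coeff f 2 * taylor_coeff f 4 - (taylor_coeff f 3)\<^sup>2"

end

theory Submission
  imports Defs
begin

text \<open>
  Write \<open>z f'(z) / f(z) = B(w(z)) = 1 + p\<^sub>1 z + p\<^sub>2 z\<^sup>2 + \<dots>\<close> with a Schwarz function
  \<open>w(z) = c\<^sub>1 z + c\<^sub>2 z\<^sup>2 + \<dots>\<close>. Comparing coefficients gives
  \<open>\<H>\<^sub>2\<^sub>,\<^sub>2(f) = c\<^sub>1 c\<^sub>3 / 3 + c\<^sub>1\<^sup>2 c\<^sub>2 / 12 - c\<^sub>2\<^sup>2 / 4 - 5 c\<^sub>1\<^sup>4 / 144\<close>.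
  Two steps of the Schur algorithm applied to \<open>w(z) / z\<close> parametrise
  \<open>c\<^sub>2 = (1 - |c\<^sub>1|\<^sup>2) x\<close> and \<open>c\<^sub>3 = (1 - |c\<^sub>1|\<^sup>2) ((1 - |x|\<^sup>2) y - cnj c\<^sub>1 x\<^sup>2)\<close> with
  \<open>|x|, |y| \<le> 1\<close>. The triangle inequality then gives a bound that increases in \<open>|x|\<close>,
  and its value at \<open>|x| = 1\<close> is at most \<open>1/4\<close>. Equality holds for \<open>w(z) = z\<^sup>2\<close>.
\<close>

section \<open>Power series expansions at the origin\<close>

lemma holomorphic_has_fps_expansion_0:
  assumes "f holomorphic_on ball 0 r" "r > 0"
  shows "f has_fps_expansion fps_expansion f 0"
  using assms by (intro has_fps_expansion_fps_expansion[of "ball 0 r"]) auto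

text \<open>Functions that agree near 0 have the same higher derivatives there. This turns
  functional identities on the disc into identities of formal power series, whose coefficients can
  be compared.\<close>

lemma has_fps_expansion_eqI:
  fixes f g :: "complex \<Rightarrow> complex"
  assumes "f has_fps_expansion F" "g has_fps_expansion G" "r > 0"
    and "\<And>z. z \<in> ball 0 r \<Longrightarrow> f z = g z"
  shows "F = G"
proof -
  have "eventually (\<lambda>z. f z = g z) (nhds 0)"
    using assms(3,4) by (intro eventually_nhds_in_open[of "ball 0 r", THEN eventually_mono]) auto
  then have "(deriv ^^ n) f 0 = (deriv ^^ n) g 0" for n
    by (rule higher_deriv_cong_ev) simp
  then show ?thesis
    using fps_nth_fps_expansion[OF assms(1)] fps_nth_fps_expansion[OF assms(2)]
    by (simp add: fps_eq_iff)
qed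

section \<open>The Schur algorithm\<close>

text \<open>The bound is not strict, so that unimodular constants are included; they arise as
  \<open>w z / z\<close> when \<open>w\<close> is a rotation.\<close>

definition schur_fun :: "(complex \<Rightarrow> complex) \<Rightarrow> bool" where
  "schur_fun g \<longleftrightarrow> g holomorphic_on unit_disc \<and> (\<forall>z\<in>unit_disc. norm (g z) \<le> 1)"

text \<open>This is the Schwarz lemma: its growth bound controls \<open>h\<close> away from 0, its
  derivative bound controls \<open>h 0 = deriv f 0\<close>.\<close>

lemma schur_fun_divide_X:
  assumes "f holomorphic_on unit_disc" "f 0 = 0" "\<And>z. norm z < 1 \<Longrightarrow> norm (f z) < 1"
  obtains h where "schur_fun h" "\<And>z. norm z < 1 \<Longrightarrow> f z = z * h z"
proof -
  obtain h where h: "h holomorphic_on unit_disc" "\<And>z. norm z < 1 \<Longrightarrow> f z = z * h z"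
    "deriv f 0 = h 0"
    using Schwarz3[OF assms(1,2)] by metis
  have "norm (h z) \<le> 1" if z: "norm z < 1" for z
  proof (cases "z = 0")
    case True
    then show ?thesis
      using Schwarz_Lemma(2)[OF assms z] h(3) by simp
  next
    case False
    have "norm z * norm (h z) \<le> norm z * 1"
      using Schwarz_Lemma(1)[OF assms z] h(2)[OF z] by (simp add: norm_mult)
    then show ?thesis
      using False by (simp add: mult_le_cancel_left)
  qed
  then show ?thesis
    using that[of h] h by (simp add: schur_fun_def)
qed

text \<open>By the maximum modulus principle, modulus 1 at an interior point forces a
  constant.\<close>

lemma schur_fun_cases:
  assumes "schur_fun g"
  obtains c where "\<And>z. norm z < 1 \<Longrightarrow> g z = c" | "\<And>z. norm z < 1 \<Longrightarrow> norm (g z) < 1"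
proof (cases "\<exists>\<xi>. norm \<xi> < 1 \<and> norm (g \<xi>) = 1")
  case True
  then obtain \<xi> where \<xi>: "norm \<xi> < 1" "norm (g \<xi>) = 1" by blast
  have "g constant_on unit_disc"
    by (rule maximum_modulus_principle[where U = unit_disc and \<xi> = \<xi>])
      (use assms \<xi> in \<open>auto simp: schur_fun_def\<close>)
  then show ?thesis
    using that(1) by (auto simp: constant_on_def)
next
  case False
  then show ?thesis
    using assms that(2) by (force simp: schur_fun_def)
qed

text \<open>The Moebius map taking \<open>g 0\<close> to 0, composed with \<open>g\<close>, vanishes
  at 0 and can be divided by \<open>z\<close>. Clearing the denominator lets the identity cover
  constants as well.\<close>

lemma schur_step:
  assumes "schur_fun g"
  obtains h where "schur_fun h"
    "\<And>z. norm z < 1 \<Longrightarrow> g z - g 0 = z * h z * (1 - cnj (g 0) * g z)"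
  using assms
proof (cases rule: schur_fun_cases)
  case (1 c)
  then show ?thesis
    \<comment> \<open>For constant \<open>g\<close> the left side vanishes, so \<open>h = 0\<close>
      works even if \<open>norm c = 1\<close>, where the Moebius denominator would be 0.\<close>
    using that[of "\<lambda>_. 0"] by (simp add: schur_fun_def)
next
  case 2
  have ne: "1 - cnj (g 0) * g z \<noteq> 0" if "norm z < 1" for z
  proof
    assume "1 - cnj (g 0) * g z = 0"
    then have "norm (g 0) * norm (g z) = 1"
      by (metis complex_mod_cnj norm_mult norm_one right_minus_eq)
    moreover have "norm (g 0) * norm (g z) < 1 * 1"
      using 2[of 0] 2[OF that] by (intro mult_strict_mono') auto
    ultimately show False by simp
  qed
  define f where "f z = Moebius_function 0 (g 0) (g z)" for z
  have "f holomorphic_on unit_disc"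
    unfolding f_def Moebius_function_simple
    using assms ne by (auto intro!: holomorphic_intros simp: schur_fun_def)
  moreover have "f 0 = 0"
    by (simp add: f_def Moebius_function_eq_zero)
  moreover have "norm (f z) < 1" if "norm z < 1" for z
    unfolding f_def using 2[of 0] 2[OF that] by (intro Moebius_function_norm_lt_1) auto
  ultimately obtain h where h: "schur_fun h" "\<And>z. norm z < 1 \<Longrightarrow> f z = z * h z"
    using schur_fun_divide_X[of f] by metis
  have "g z - g 0 = z * h z * (1 - cnj (g 0) * g z)" if "norm z < 1" for z
    using h(2)[OF that] ne[OF that] by (simp add: f_def Moebius_function_simple field_simps)
  then show ?thesis
    using that[OF h(1)] by blast
qed

lemma schur_fun_fps:
  assumes "schur_fun g"
  shows "g has_fps_expansion fps_expansion g 0" "norm (fps_nth (fps_expansion g 0) 0) \<le> 1"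
proof -
  show "g has_fps_expansion fps_expansion g 0"
    using assms holomorphic_has_fps_expansion_0[of g 1] by (simp add: schur_fun_def)
  show "norm (fps_nth (fps_expansion g 0) 0) \<le> 1"
    using assms by (simp add: schur_fun_def fps_expansion_def)
qed

text \<open>The coefficients of \<open>z\<close> and \<open>z^2\<close> in the identity of
  \<open>schur_step\<close> are compared, with \<open>1 - cnj (g 0) * g 0\<close> rewritten as a
  real number.\<close>

lemma schur_step_fps:
  fixes G :: "complex fps"
  assumes "schur_fun g" "g has_fps_expansion G"
  obtains h :: "complex \<Rightarrow> complex" and H :: "complex fps" where "schur_fun h" "h has_fps_expansion H"
    "fps_nth G 1 = (1 - (norm (fps_nth G 0))\<^sup>2) * fps_nth H 0"
    "fps_nth G 2 = (1 - (norm (fps_nth G 0))\<^sup>2) * fps_nth H 1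
                   - cnj (fps_nth G 0) * fps_nth G 1 * fps_nth H 0"
proof -
  obtain h where h: "schur_fun h"
    "\<And>z. norm z < 1 \<Longrightarrow> g z - g 0 = z * h z * (1 - cnj (g 0) * g z)"
    using schur_step[OF assms(1)] by blast
  define H where "H = fps_expansion h 0"
  have H: "h has_fps_expansion H"
    using schur_fun_fps[OF h(1)] by (simp add: H_def)
  have g0: "fps_nth G 0 = g 0"
    using fps_nth_fps_expansion[OF assms(2), of 0] by simp
  have eq: "G - fps_const (g 0) = fps_X * H * (1 - fps_const (cnj (g 0)) * G)"
    by (rule has_fps_expansion_eqI[of "\<lambda>z. g z - g 0" _
          "\<lambda>z. z * h z * (1 - cnj (g 0) * g z)" _ 1])
      (use assms H h in \<open>auto intro!: fps_expansion_intros\<close>)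
  have sq: "1 - cnj (g 0) * g 0 = of_real (1 - (norm (g 0))\<^sup>2)"
    by (simp add: complex_norm_square mult.commute del: of_real_power)
  have c1: "fps_nth G 1 = fps_nth H 0 * (1 - cnj (g 0) * g 0)"
    using arg_cong[OF eq, of "\<lambda>F. fps_nth F 1"] by (simp add: fps_mult_nth_1 g0)
  have c2: "fps_nth G 2 = fps_nth H 1 * (1 - cnj (g 0) * g 0)
      - cnj (g 0) * fps_nth G 1 * fps_nth H 0"
    using arg_cong[OF eq, of "\<lambda>F. fps_nth F 2"]
    by (simp add: fps_mult_nth numeral_2_eq_2 g0 algebra_simps)
  show ?thesis
  proof (rule that[OF h(1) H])
    show "fps_nth G 1 = (1 - (norm (fps_nth G 0))\<^sup>2) * fps_nth H 0"
      unfolding g0 sq[symmetric] c1 by (rule mult.commute)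
    show "fps_nth G 2 = (1 - (norm (fps_nth G 0))\<^sup>2) * fps_nth H 1
        - cnj (fps_nth G 0) * fps_nth G 1 * fps_nth H 0"
      unfolding g0 sq[symmetric] c2 by (simp only: mult.commute)
  qed
qed

text \<open>The parameters are the values at 0 of the first and second Schur iterates of
  \<open>w z / z\<close>.\<close>

proposition schwarz_coeffs:
  fixes W :: "complex fps"
  assumes "w holomorphic_on unit_disc" "w ` unit_disc \<subseteq> unit_disc" "w 0 = 0"
    and "w has_fps_expansion W"
  obtains x y :: complex where "norm (fps_nth W 1) \<le> 1" "norm x \<le> 1" "norm y \<le> 1"
    "fps_nth W 2 = (1 - (norm (fps_nth W 1))\<^sup>2) * x"
    "fps_nth W 3 = (1 - (norm (fps_nth W 1))\<^sup>2) *
       ((1 - (norm x)\<^sup>2) * y - cnj (fps_nth W 1) * x\<^sup>2)"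
proof -
  obtain g where g: "schur_fun g" "\<And>z. norm z < 1 \<Longrightarrow> w z = z * g z"
    using schur_fun_divide_X[of w] assms(1-3) by (auto simp: image_subset_iff)
  define G where "G = fps_expansion g 0"
  have G: "g has_fps_expansion G" "norm (fps_nth G 0) \<le> 1"
    using schur_fun_fps[OF g(1)] by (simp_all add: G_def)
  have W: "W = fps_X * G"
    by (rule has_fps_expansion_eqI[OF assms(4), of "\<lambda>z. z * g z" _ 1])
      (use G g in \<open>auto intro!: fps_expansion_intros\<close>)
  obtain h and H :: "complex fps" where H: "schur_fun h" "h has_fps_expansion H"
    "fps_nth G 1 = (1 - (norm (fps_nth G 0))\<^sup>2) * fps_nth H 0"
    "fps_nth G 2 = (1 - (norm (fps_nth G 0))\<^sup>2) * fps_nth H 1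
                   - cnj (fps_nth G 0) * fps_nth G 1 * fps_nth H 0"
    using schur_step_fps[OF g(1) G(1)] by blast
  obtain k and K :: "complex fps" where K: "schur_fun k" "k has_fps_expansion K"
    "fps_nth H 1 = (1 - (norm (fps_nth H 0))\<^sup>2) * fps_nth K 0"
    using schur_step_fps[OF H(1,2)] by metis
  have "norm (fps_nth H 0) \<le> 1" "norm (fps_nth K 0) \<le> 1"
    using H(1) K(1) fps_nth_fps_expansion[OF H(2), of 0] fps_nth_fps_expansion[OF K(2), of 0]
    by (auto simp: schur_fun_def)
  moreover have "fps_nth W 1 = fps_nth G 0" "fps_nth W 2 = fps_nth G 1"
    "fps_nth W 3 = fps_nth G 2"
    by (simp_all add: W)
  \<comment> \<open>Inserting the formula for the first coefficient of \<open>G\<close> into the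
    correction term makes \<open>1 - (norm (fps_nth G 0))^2\<close> a common factor.\<close>
  moreover have "fps_nth G 2 = (1 - (norm (fps_nth G 0))\<^sup>2) *
       ((1 - (norm (fps_nth H 0))\<^sup>2) * fps_nth K 0 - cnj (fps_nth G 0) * (fps_nth H 0)\<^sup>2)"
    unfolding H(4) H(3) K(3) by (simp add: power2_eq_square algebra_simps)
  ultimately show ?thesis
    using that[of "fps_nth H 0" "fps_nth K 0"] G(2) H(3) by metis
qed

section \<open>The Hankel determinant in terms of the Schwarz function\<close>

text \<open>The point \<open>1 + z\<close> lies in the right half-plane, off the branch cut. A zero
  of the denominator would mean \<open>1 + z = e\<close>, but
  \<open>norm (1 + z) < 2 \<le> e\<close>.\<close>

lemma B_fun_denominator:
  assumes "norm z < 1"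
  shows "1 + z \<notin> \<real>\<^sub>\<le>\<^sub>0" "1 - Ln (1 + z) \<noteq> 0"
proof -
  have "Re z > -1"
    using abs_Re_le_cmod[of z] assms by linarith
  then show *: "1 + z \<notin> \<real>\<^sub>\<le>\<^sub>0"
    by (auto simp: complex_nonpos_Reals_iff)
  show "1 - Ln (1 + z) \<noteq> 0"
  proof
    assume "1 - Ln (1 + z) = 0"
    then have "exp 1 = 1 + z"
      using * by (metis exp_Ln nonpos_Reals_zero_I eq_iff_diff_eq_0)
    then have "norm (exp 1 :: complex) \<le> 1 + norm z"
      using norm_triangle_ineq[of 1 z] by simp
    moreover have "exp 1 \<ge> (2::real)"
      using exp_ge_add_one_self[of 1] by simp
    ultimately show False
      using assms by simp
  qed
qed

lemma B_fun_holomorphic: "B_fun holomorphic_on unit_disc"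
  unfolding B_fun_def using B_fun_denominator by (auto intro!: holomorphic_intros)

lemma deriv_B_fun:
  assumes "norm z < 1"
  shows "(B_fun has_field_derivative (B_fun z)\<^sup>2 / (1 + z)) (at z)"
proof -
  have "1 + z \<noteq> 0"
    using B_fun_denominator(1)[OF assms] by force
  then show ?thesis
    unfolding B_fun_def using B_fun_denominator[OF assms]
    by (auto intro!: derivative_eq_intros simp: field_simps power2_eq_square)
qed

text \<open>The differential equation \<open>(1 + z) B' = B\<^sup>2\<close> spares expanding the logarithm.\<close>

lemma B_fun_comp_coeffs:
  assumes "w holomorphic_on unit_disc" "w ` unit_disc \<subseteq> unit_disc" "w 0 = 0"
    and "w has_fps_expansion W" "(\<lambda>z. B_fun (w z)) has_fps_expansion P"
  shows "fps_nth P 0 = 1" "fps_nth P 1 = fps_nth W 1"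
    "fps_nth P 2 = fps_nth W 2 + (fps_nth W 1)\<^sup>2 / 2"
    "fps_nth P 3 = fps_nth W 3 + fps_nth W 1 * fps_nth W 2 + (fps_nth W 1)^3 / 3"
proof -
  have ode: "(1 + w z) * deriv (\<lambda>z. B_fun (w z)) z = (B_fun (w z))\<^sup>2 * deriv w z"
    if "z \<in> unit_disc" for z
  proof -
    have wz: "norm (w z) < 1"
      using assms(2) that by (auto simp: image_subset_iff)
    have "(w has_field_derivative deriv w z) (at z)"
      using assms(1) that by (auto intro: holomorphic_derivI)
    from DERIV_chain2[OF deriv_B_fun[OF wz] this]
    have "deriv (\<lambda>z. B_fun (w z)) z = (B_fun (w z))\<^sup>2 / (1 + w z) * deriv w z"
      by (rule DERIV_imp_deriv)
    moreover have "1 + w z \<noteq> 0"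
      using B_fun_denominator(1)[OF wz] by force
    ultimately show ?thesis by simp
  qed
  have eq: "(1 + W) * fps_deriv P = P^2 * fps_deriv W"
    by (rule has_fps_expansion_eqI[OF _ _ zero_less_one ode])
      (auto intro!: fps_expansion_intros assms)
  show P0: "fps_nth P 0 = 1"
    using fps_nth_fps_expansion[OF assms(5), of 0] assms(3) by (simp add: B_fun_def)
  have W0: "fps_nth W 0 = 0"
    using fps_nth_fps_expansion[OF assms(4), of 0] assms(3) by simp
  note coeff = fps_mult_nth power2_eq_square numeral_2_eq_2 numeral_3_eq_3 P0 W0
  \<comment> \<open>Since \<open>P\<close> has constant term 1 and \<open>W\<close> has none, the
    coefficients of order 0, 1, 2 in \<open>eq\<close> determine those of \<open>P\<close> of order
    1, 2, 3 in turn.\<close>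
  show P1: "fps_nth P 1 = fps_nth W 1"
    using arg_cong[OF eq, of "\<lambda>F. fps_nth F 0"] by (simp add: coeff)
  show P2: "fps_nth P 2 = fps_nth W 2 + (fps_nth W 1)\<^sup>2 / 2"
    using arg_cong[OF eq, of "\<lambda>F. fps_nth F 1"] P1 by (simp add: coeff field_simps)
  show "fps_nth P 3 = fps_nth W 3 + fps_nth W 1 * fps_nth W 2 + (fps_nth W 1)^3 / 3"
    using arg_cong[OF eq, of "\<lambda>F. fps_nth F 2"] P1 P2 by (simp add: coeff field_simps)
qed

lemma hankel_2_2_eq:
  assumes "f \<in> class_A" "\<And>z. z \<in> unit_disc - {0} \<Longrightarrow> f z \<noteq> 0"
    and "w holomorphic_on unit_disc" "w ` unit_disc \<subseteq> unit_disc" "w 0 = 0"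
    and "w has_fps_expansion W"
    and "\<And>z. z \<in> unit_disc \<Longrightarrow> log_deriv_quot f z = B_fun (w z)"
  shows "hankel_2_2 f = fps_nth W 1 * fps_nth W 3 / 3 + (fps_nth W 1)\<^sup>2 * fps_nth W 2 / 12
    - (fps_nth W 2)\<^sup>2 / 4 - 5 * (fps_nth W 1)^4 / 144"
proof -
  define F where "F = fps_expansion f 0"
  define P where "P = fps_expansion (\<lambda>z. B_fun (w z)) 0"
  have F: "f has_fps_expansion F"
    using assms(1) unfolding F_def class_A_def
    by (auto intro: holomorphic_has_fps_expansion_0[of _ 1])
  have "(B_fun \<circ> w) holomorphic_on unit_disc"
    using assms(3) B_fun_holomorphic assms(4) by (rule holomorphic_on_compose_gen)
  then have P: "(\<lambda>z. B_fun (w z)) has_fps_expansion P"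
    unfolding P_def comp_def by (auto intro: holomorphic_has_fps_expansion_0[of _ 1])
  have F0: "fps_nth F 0 = 0" and F1: "fps_nth F 1 = 1"
    using assms(1) fps_nth_fps_expansion[OF F, of 0] fps_nth_fps_expansion[OF F, of 1]
    by (auto simp: class_A_def)
  \<comment> \<open>Nonvanishing of \<open>f\<close> clears the denominator away from 0; at 0 both
    sides vanish.\<close>
  have "z * deriv f z = B_fun (w z) * f z" if z: "z \<in> unit_disc" for z
    using assms(1) assms(2)[of z] assms(7)[OF z] z
    by (cases "z = 0") (auto simp: log_deriv_quot_def class_A_def field_simps)
  then have eq: "fps_X * fps_deriv F = P * F"
    by (intro has_fps_expansion_eqI[of "\<lambda>z. z * deriv f z" _ "\<lambda>z. B_fun (w z) * f z" _ 1])
      (auto intro!: fps_expansion_intros F P)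
  note p = B_fun_comp_coeffs[OF assms(3-6) P]
  \<comment> \<open>As \<open>P\<close> has constant term 1, the coefficient of order n in
    \<open>eq\<close> gives (n - 1) a_n = p_1 a_(n-1) + ... + p_(n-1) a_1.\<close>
  have a2: "fps_nth F 2 = fps_nth P 1"
    using arg_cong[OF eq, of "\<lambda>F. fps_nth F 2"] F0 F1 p(1)
    by (simp add: fps_mult_nth eval_nat_numeral)
  have a3: "fps_nth F 3 = (fps_nth P 2 + (fps_nth P 1)\<^sup>2) / 2"
    using arg_cong[OF eq, of "\<lambda>F. fps_nth F 3"] a2 F0 F1 p(1)
    by (simp add: fps_mult_nth eval_nat_numeral field_simps)
  have "3 * fps_nth F 4 = fps_nth P 3 + fps_nth P 2 * fps_nth P 1 + fps_nth P 1 * fps_nth F 3"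
    using arg_cong[OF eq, of "\<lambda>F. fps_nth F 4"] a2 F0 F1 p(1)
    by (simp add: fps_mult_nth eval_nat_numeral field_simps)
  then have a4: "fps_nth F 4 = (2 * fps_nth P 3 + 3 * fps_nth P 1 * fps_nth P 2 + (fps_nth P 1)^3) / 6"
    unfolding a3 by (simp add: field_simps power2_eq_square power3_eq_cube)
  show ?thesis
    unfolding hankel_2_2_def taylor_coeff_def F_def[symmetric] a2 a3 a4 p
    by (simp add: field_simps eval_nat_numeral)
qed

section \<open>The sharp bound\<close>

text \<open>Here \<open>c\<close>, \<open>X\<close>, \<open>Y\<close> stand for the moduli of the
  first Schwarz coefficient and of the two Schur parameters.\<close>

lemma hankel_bound_real:
  fixes c X Y :: real
  assumes "0 \<le> c" "c \<le> 1" "0 \<le> X" "X \<le> 1" "0 \<le> Y" "Y \<le> 1"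
  shows "(1 - c\<^sup>2) * ((3 + c\<^sup>2) * X\<^sup>2 / 12 + c * (1 - X\<^sup>2) * Y / 3 + c\<^sup>2 * X / 12)
    + 5 * c^4 / 144 \<le> 1 / 4"
proof -
  have t: "0 \<le> 1 - c\<^sup>2"
    using assms by (simp add: power_le_one)
  have X2: "X\<^sup>2 \<le> 1"
    using assms by (simp add: power_le_one)
  have "c * (1 - X\<^sup>2) * Y \<le> c * (1 - X\<^sup>2)"
    using assms X2 by (intro mult_left_le) auto
  moreover have "c\<^sup>2 * X \<le> c\<^sup>2"
    using assms by (intro mult_left_le) auto
  \<comment> \<open>The difference from the value at \<open>X = 1\<close> is isolated, using 3 + c^2
    - 4c = (1 - c)(3 - c); it has a sign because \<open>c \<le> 1\<close>.\<close>
  moreover have "(3 + c\<^sup>2) * X\<^sup>2 / 12 + c * (1 - X\<^sup>2) / 3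
      = (3 + c\<^sup>2) / 12 - (1 - X\<^sup>2) * ((1 - c) * (3 - c)) / 12"
    by (simp add: field_simps power2_eq_square)
  moreover have "0 \<le> (1 - X\<^sup>2) * ((1 - c) * (3 - c))"
    using assms X2 by (intro mult_nonneg_nonneg) auto
  ultimately have "(3 + c\<^sup>2) * X\<^sup>2 / 12 + c * (1 - X\<^sup>2) * Y / 3 + c\<^sup>2 * X / 12
      \<le> (3 + 2 * c\<^sup>2) / 12"
    by (simp add: field_simps)
  from mult_left_mono[OF this t] 
  have "(1 - c\<^sup>2) * ((3 + c\<^sup>2) * X\<^sup>2 / 12 + c * (1 - X\<^sup>2) * Y / 3 + c\<^sup>2 * X / 12)
      + 5 * c^4 / 144 \<le> (1 - c\<^sup>2) * ((3 + 2 * c\<^sup>2) / 12) + 5 * c^4 / 144"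
    by simp
  also have "\<dots> = 1 / 4 - c\<^sup>2 / 12 - 19 * c^4 / 144"
    by (simp add: field_simps eval_nat_numeral)
  also have "\<dots> \<le> 1 / 4"
    using zero_le_power2[of c] zero_le_power[OF assms(1), of 4] by linarith
  finally show ?thesis .
qed

lemma schwarz_hankel_bound:
  assumes "w holomorphic_on unit_disc" "w ` unit_disc \<subseteq> unit_disc" "w 0 = 0"
    and "w has_fps_expansion W"
  shows "norm (fps_nth W 1 * fps_nth W 3 / 3 + (fps_nth W 1)\<^sup>2 * fps_nth W 2 / 12
    - (fps_nth W 2)\<^sup>2 / 4 - 5 * (fps_nth W 1)^4 / 144) \<le> 1 / 4"
proof -
  obtain x y :: complex where xy: "norm (fps_nth W 1) \<le> 1" "norm x \<le> 1" "norm y \<le> 1"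
    and W2: "fps_nth W 2 = (1 - (norm (fps_nth W 1))\<^sup>2) * x"
    and W3: "fps_nth W 3 = (1 - (norm (fps_nth W 1))\<^sup>2) *
       ((1 - (norm x)\<^sup>2) * y - cnj (fps_nth W 1) * x\<^sup>2)"
    using schwarz_coeffs[OF assms] by metis
  define a where "a = fps_nth W 1"
  define c where "c = norm a"
  define X where "X = norm x"
  have t: "0 \<le> 1 - c\<^sup>2" and s: "0 \<le> 1 - X\<^sup>2"
    using xy by (simp_all add: a_def c_def X_def power_le_one)
  have ac: "a * cnj a = of_real (c\<^sup>2)"
    by (simp add: c_def complex_norm_square del: of_real_power)
  have norm_scale: "norm (of_real r * u) = r * norm u" if "0 \<le> r" for r and u :: complex
    using that by (simp add: norm_mult)
  \<comment> \<open>The \<open>x^2\<close> terms come from \<open>a * fps_nth W 3 / 3\<close> and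
    \<open>(fps_nth W 2)^2 / 4\<close>; they combine through c^2/3 + (1 - c^2)/4 = (3 +
    c^2)/12.\<close>
  let ?T1 = "of_real ((1 - c\<^sup>2) * (3 + c\<^sup>2) / 12) * x\<^sup>2"
  let ?T2 = "of_real ((1 - c\<^sup>2) * (1 - X\<^sup>2) / 3) * (a * y)"
  let ?T3 = "of_real ((1 - c\<^sup>2) / 12) * (a\<^sup>2 * x)"
  let ?T4 = "5 / 144 * a^4"
  have T1: "norm ?T1 = (1 - c\<^sup>2) * ((3 + c\<^sup>2) * X\<^sup>2 / 12)"
    using t by (subst norm_scale) (simp_all add: norm_power X_def)
  have T2: "norm ?T2 = (1 - c\<^sup>2) * (c * (1 - X\<^sup>2) * norm y / 3)"
    using t s by (subst norm_scale) (simp_all add: norm_mult c_def)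
  have T3: "norm ?T3 = (1 - c\<^sup>2) * (c\<^sup>2 * X / 12)"
    using t by (subst norm_scale) (simp_all add: norm_mult norm_power c_def X_def)
  have T4: "norm ?T4 = 5 * c^4 / 144"
    by (simp add: norm_mult norm_power c_def)
  have aW3: "a * fps_nth W 3 = of_real (1 - c\<^sup>2) *
      (of_real (1 - X\<^sup>2) * (a * y) - of_real (c\<^sup>2) * x\<^sup>2)"
    unfolding W3 a_def[symmetric] c_def[symmetric] X_def[symmetric] ac[symmetric]
    by (simp add: algebra_simps)
  have "a * fps_nth W 3 / 3 + a\<^sup>2 * fps_nth W 2 / 12 - (fps_nth W 2)\<^sup>2 / 4 - 5 * a^4 / 144
      = - ?T1 + ?T2 + ?T3 - ?T4"
    unfolding aW3 W2 a_def[symmetric] c_def[symmetric]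
    by (simp add: field_simps power2_eq_square)
  moreover have "norm (- ?T1 + ?T2 + ?T3 - ?T4) \<le> norm ?T1 + norm ?T2 + norm ?T3 + norm ?T4"
    by (smt (verit) norm_minus_cancel norm_triangle_ineq norm_triangle_ineq4)
  moreover have "norm ?T1 + norm ?T2 + norm ?T3 + norm ?T4 \<le> 1 / 4"
    unfolding T1 T2 T3 T4 distrib_left[symmetric]
    using xy by (intro hankel_bound_real) (simp_all add: a_def c_def X_def)
  ultimately show ?thesis
    unfolding a_def[symmetric] by (simp only: order_trans)
qed

section \<open>Members of the class with a prescribed Schwarz function, and sharpness\<close>

text \<open>The equation z f'/f = B(w) is integrated: \<open>f z = z * exp (Q z)\<close>, where Q' =
  (B(w) - 1)/z. The exponential keeps \<open>f\<close> nonzero off the origin.\<close>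

lemma starlike_B_exists:
  assumes "w holomorphic_on unit_disc" "w ` unit_disc \<subseteq> unit_disc" "w 0 = 0"
  obtains f where "f \<in> starlike_B" "\<And>z. z \<in> unit_disc \<Longrightarrow> log_deriv_quot f z = B_fun (w z)"
proof -
  have "(B_fun \<circ> w) holomorphic_on unit_disc"
    using assms(1) B_fun_holomorphic assms(2) by (rule holomorphic_on_compose_gen)
  then have Bw: "(\<lambda>z. B_fun (w z)) holomorphic_on unit_disc"
    by (simp add: comp_def)
  then have "(\<lambda>z. B_fun (w z) - 1) holomorphic_on unit_disc" "B_fun (w 0) - 1 = 0"
    using assms(3) by (auto intro!: holomorphic_intros simp: B_fun_def)
  \<comment> \<open>\<open>Schwarz3\<close> is used only to remove the singularity of (B(w) - 1)/z
    at 0.\<close>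
  then obtain q where q: "q holomorphic_on unit_disc"
    "\<And>z. norm z < 1 \<Longrightarrow> B_fun (w z) - 1 = z * q z"
    using Schwarz3[of "\<lambda>z. B_fun (w z) - 1" 1] by metis
  obtain Q0 where Q0: "\<And>z. z \<in> unit_disc \<Longrightarrow> (Q0 has_field_derivative q z) (at z within unit_disc)"
    using holomorphic_convex_primitive'[OF _ _ q(1)] by auto
  \<comment> \<open>Normalising \<open>Q 0 = 0\<close> yields \<open>deriv f 0 = 1\<close>.\<close>
  define Q where "Q z = Q0 z - Q0 0" for z
  have Q: "(Q has_field_derivative q z) (at z)" if "z \<in> unit_disc" for z
    using Q0[OF that] that unfolding Q_def
    by (auto intro!: derivative_eq_intros simp: at_within_open[of _ unit_disc])
  define f where "f z = z * exp (Q z)" for z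
  have f: "(f has_field_derivative B_fun (w z) * exp (Q z)) (at z)" if "z \<in> unit_disc" for z
  proof -
    have "B_fun (w z) = 1 + z * q z"
      using q(2)[of z] that by (simp add: diff_eq_eq add.commute)
    then show ?thesis
      unfolding f_def by (auto intro!: derivative_eq_intros Q that simp: algebra_simps)
  qed
  have df: "deriv f z = B_fun (w z) * exp (Q z)" if "z \<in> unit_disc" for z
    using f[OF that] by (rule DERIV_imp_deriv)
  \<comment> \<open>At 0 the value 1 fixed in \<open>log_deriv_quot\<close> matches
    \<open>B_fun 0 = 1\<close>.\<close>
  have ldq: "log_deriv_quot f z = B_fun (w z)" if "z \<in> unit_disc" for z
    using df[OF that] assms(3) by (auto simp: log_deriv_quot_def f_def B_fun_def)
  have "f holomorphic_on unit_disc"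
    using f unfolding holomorphic_on_open[OF open_ball] by blast
  then have "f \<in> class_A"
    using df[of 0] assms(3) by (simp add: class_A_def f_def Q_def B_fun_def)
  moreover have "log_deriv_quot f holomorphic_on unit_disc"
    using Bw by (rule holomorphic_transform) (simp add: ldq)
  then have "subordinate (log_deriv_quot f) B_fun"
    unfolding subordinate_def using B_fun_holomorphic assms ldq by blast
  ultimately have "f \<in> starlike_B"
    by (simp add: starlike_B_def f_def)
  then show ?thesis
    using that ldq by blast
qed

theorem theorem3p3:
  "(\<forall>f\<in>starlike_B. norm (hankel_2_2 f) \<le> 1 / 4) \<and>
   (\<exists>f\<in>starlike_B. norm (hankel_2_2 f) = 1 / 4)"
proof (intro conjI ballI)
  fix f assume f: "f \<in> starlike_B"
  then obtain w where w: "w holomorphic_on unit_disc" "w ` unit_disc \<subseteq> unit_disc" "w 0 = 0"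
    "\<And>z. z \<in> unit_disc \<Longrightarrow> log_deriv_quot f z = B_fun (w z)"
    by (auto simp: starlike_B_def subordinate_def)
  have W: "w has_fps_expansion fps_expansion w 0"
    using w(1) by (rule holomorphic_has_fps_expansion_0) simp
  show "norm (hankel_2_2 f) \<le> 1 / 4"
    using f schwarz_hankel_bound[OF w(1-3) W]
    by (subst hankel_2_2_eq[OF _ _ w(1-3) W w(4)]) (auto simp: starlike_B_def)
next
  let ?w = "\<lambda>z :: complex. z^2"
  have w: "?w holomorphic_on unit_disc" "?w ` unit_disc \<subseteq> unit_disc" "?w 0 = 0"
    by (auto intro!: holomorphic_intros simp: norm_power power_less_one_iff abs_square_less_1)
  have W: "?w has_fps_expansion fps_X^2"
    by (rule has_fps_expansion_fps_X_power)
  obtain f where f: "f \<in> starlike_B" "\<And>z. z \<in> unit_disc \<Longrightarrow> log_deriv_quot f z = B_fun (?w z)"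
    using starlike_B_exists[OF w] by blast
  \<comment> \<open>Only the second coefficient of \<open>z^2\<close> is nonzero, so just the term
    \<open>- (fps_nth W 2)^2 / 4\<close> survives.\<close>
  have "hankel_2_2 f = - 1 / 4"
    using f(1) by (subst hankel_2_2_eq[OF _ _ w W f(2)]) (auto simp: starlike_B_def fps_X_power_nth)
  then show "\<exists>f\<in>starlike_B. norm (hankel_2_2 f) = 1 / 4"
    using f(1) by (intro bexI[of _ f]) simp_all
qed

end
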